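(* Let $\mathcal{P}$ be the set of integer partitions satisfying all of the following: (i) adjacent parts do not differ by exactly $1$; (ii) even parts do not repeat; (iii) for all integers $j\ge 0$ and $0\le t\le 3$, $(2j+1)+(2j+1)+(2j+1+t)$ does not occur as a sub-partition; (iv) for all integers $j\ge 0$ and $0\le t\le 2$, $(2j+1-t)+(2j+1)+(2j+1)$ does not occur as a sub-partition; (v) for all integers $j\ge 0$, $(2j+1)+(2j+3)+(2j+5)$ does not occur as a sub-partition. Let $\mathcal{P}'$ be the set of $\pi\in\mathcal{P}$ in which $1$ does not appear as a part. Then, as formal power series in $x,q$, writing $N=i+2j+3k$, $$\sum_{\pi\in\mathcal{P}}x^{\ell(\pi)}q^{|\pi|}=\sum_{i,j,k\ge 0}(-1)^k\frac{x^{N}q^{N(N-1)+i+3k^2}}{(q;q)_i\,(q^4;q^4)_j\,(q^6;q^6)_k},$$ $$\sum_{\pi\in\mathcal{P}'}x^{\ell(\pi)}q^{|\pi|}=\sum_{i,j,k\ge 0}(-1)^k\frac{x^{N}q^{N(N-1)+2i+4j+3k^2+6k}}{(q;q)_i\,(q^4;q^4)_j\,(q^6;q^6)_k}.$$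
   Context: Partitions are finite weakly increasing sequences of positive integers (the empty partition is included); $\ell(\pi)$ is the number of parts and $|\pi|$ the sum of the parts of $\pi$. A sub-partition of a partition is a contiguous portion of it. For $n\ge 0$, $(a;q)_n=\prod_{0\le t<n}(1-aq^t)$. All identities are identities of formal power series. *)

theory Defs
  imports "HOL-Analysis.Infinite_Sum" "HOL-Library.Sublist"
    "HOL-Computational_Algebra.Formal_Power_Series"
begin

definition integer_partitions :: "nat list set" where
  "integer_partitions = {p. sorted p \<and> (\<forall>a\<in>set p. 0 < a)}"

text \<open>
  Sub-partitions are contiguous sublists. In condition (iv) the first part \<open>a\<close> is
  \<open>2j + 1 - t\<close>, written as \<open>a + t = 2j + 1\<close> to avoid truncated subtraction; for
  \<open>t > 2j + 1\<close> the value is negative and there is nothing to forbid.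
\<close>

definition P_set :: "nat list set" where
  "P_set = {p \<in> integer_partitions.
     (\<forall>a b. sublist [a, b] p \<longrightarrow> b \<noteq> a + 1) \<and>
     (\<forall>a. even a \<longrightarrow> count_list p a \<le> 1) \<and>
     (\<forall>j t. t \<le> 3 \<longrightarrow> \<not> sublist [2*j+1, 2*j+1, 2*j+1+t] p) \<and>
     (\<forall>j t a. t \<le> 2 \<and> a + t = 2*j+1 \<longrightarrow> \<not> sublist [a, 2*j+1, 2*j+1] p) \<and>
     (\<forall>j. \<not> sublist [2*j+1, 2*j+3, 2*j+5] p)}"

definition P'_set :: "nat list set" where
  "P'_set = {p \<in> P_set. 1 \<notin> set p}"

definition qpoch :: "'a::comm_ring_1 \<Rightarrow> 'a \<Rightarrow> nat \<Rightarrow> 'a" where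
  "qpoch a q n = (\<Prod>t<n. 1 - a * q ^ t)"

text \<open>
  Formal power series in \<open>x\<close> and \<open>q\<close> are series in \<open>q\<close> whose coefficients are series in \<open>x\<close>.
  The topology on \<^typ>\<open>rat fps fps\<close> is the \<open>q\<close>-adic one, in which the sums over
  partitions weighted by \<open>x\<close> to the length times \<open>q\<close> to the size converge.
  (Such sums do not in general converge \<open>x\<close>-adically, since there are
  infinitely many partitions with a given number of parts, so \<open>q\<close> is the outer variable.)
\<close>

definition var_q :: "rat fps fps" where
  "var_q = fps_X"

definition var_x :: "rat fps fps" where
  "var_x = fps_const fps_X"

end

theory Submission
  imports Defs
begin

unbundle fps_syntax

text \<open>
  Let \<open>A(x)\<close> and \<open>B(x)\<close> be the generating functions of the admissible partitions with parts at
  least \<open>1\<close> and at least \<open>2\<close>. Adding \<open>2\<close> to all parts preserves admissibility and replaces \<open>x\<close>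
  by \<open>xq\<^sup>2\<close>, so removing the smallest parts gives
  \<open>A(x) = B(x) + xq B(xq\<^sup>2) + x\<^sup>2q\<^sup>4 B(xq\<^sup>4) + x\<^sup>2q\<^sup>2 A(xq\<^sup>4)\<close> and
  \<open>B(x) = A(xq\<^sup>2) + xq\<^sup>2 B(xq\<^sup>2)\<close>, a system whose solution is determined by its constant terms.
  For the triple sums the second equation follows by cancelling \<open>1 - q\<^sup>i\<close> against \<open>(q;q)\<^sub>i\<close> and shifting
  the index \<open>i\<close>. The same manipulations in all three indices show that the defect \<open>D(x)\<close> of the
  first equation satisfies \<open>D(x) = xq D(xq\<^sup>2)\<close>, so it vanishes.
\<close>

section \<open>Admissible partitions\<close>

text \<open>Conditions (i) and (ii) together with weak increase, read at two neighbouring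
  parts.\<close>

definition adj :: "nat \<Rightarrow> nat \<Rightarrow> bool" where
  "adj a b \<longleftrightarrow> odd a \<and> b = a \<or> a + 2 \<le> b"

text \<open>The three clauses are conditions (iii), (iv) and (v).\<close>

definition tri :: "nat \<Rightarrow> nat \<Rightarrow> nat \<Rightarrow> bool" where
  "tri a b c \<longleftrightarrow> \<not> (odd a \<and> b = a \<and> c \<le> a + 3) \<and> \<not> (odd b \<and> c = b \<and> b \<le> a + 2) \<and>
     \<not> (odd a \<and> b = a + 2 \<and> c = a + 4)"

text \<open>Only windows of two and three parts are inspected. Positivity is left to
  \<open>parts_ge\<close>, so that nothing here depends on the absolute size of a part.\<close>

fun admissible :: "nat list \<Rightarrow> bool" where
  "admissible [] \<longleftrightarrow> True"
| "admissible [a] \<longleftrightarrow> True"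
| "admissible [a, b] \<longleftrightarrow> adj a b"
| "admissible (a # b # c # p) \<longleftrightarrow> adj a b \<and> tri a b c \<and> admissible (b # c # p)"

definition parts_ge :: "nat \<Rightarrow> nat list set" where
  "parts_ge k = {p. admissible p \<and> (\<forall>a\<in>set p. k \<le> a)}"

section \<open>Equivalence of the local conditions with (i)-(v)\<close>

lemma admissible_Cons_le: "admissible (a # p) \<Longrightarrow> b \<in> set p \<Longrightarrow> a \<le> b"
proof (induction "a # p" arbitrary: a p rule: admissible.induct)
  case (4 a b' c p)
  then show ?case by (fastforce simp: adj_def)
qed (auto simp: adj_def)

lemma admissible_tl: "admissible (a # p) \<Longrightarrow> admissible p"
  by (cases "a # p" rule: admissible.cases) auto

lemma admissible_sorted: "admissible p \<Longrightarrow> sorted p"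
  by (induction p) (use admissible_Cons_le admissible_tl in auto)

lemma Cons_in_parts_ge: "a # p \<in> parts_ge k \<longleftrightarrow> admissible (a # p) \<and> k \<le> a"
  unfolding parts_ge_def using admissible_Cons_le by fastforce

text \<open>Equal parts of an increasing list are neighbours, and \<open>adj\<close> rejects equal
  even neighbours.\<close>

lemma admissible_even_count: "admissible p \<Longrightarrow> even a \<Longrightarrow> count_list p a \<le> 1"
proof (induction p)
  case (Cons b p)
  show ?case
  proof (cases "b = a")
    case True
    have "a \<notin> set p"
    proof
      assume "a \<in> set p"
      then obtain c r where p: "p = c # r" by (cases p) auto
      have "a + 2 \<le> c"
        using Cons.prems True p by (cases r) (auto simp: adj_def)
      moreover have "c \<le> a"
        using admissible_Cons_le[of c r a] admissible_tl[OF Cons.prems(1)] \<open>a \<in> set p\<close> p by auto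
      ultimately show False by simp
    qed
    then show ?thesis using True by (simp add: count_notin)
  next
    case False
    then show ?thesis using Cons admissible_tl by auto
  qed
qed simp

lemma admissible_sublist2: "admissible p \<Longrightarrow> sublist [a, b] p \<Longrightarrow> adj a b"
  by (induction p rule: admissible.induct) (auto simp: sublist_Cons_right)

lemma admissible_sublist3: "admissible p \<Longrightarrow> sublist [a, b, c] p \<Longrightarrow> tri a b c"
  by (induction p rule: admissible.induct) (auto simp: sublist_Cons_right)

lemma P_set_ConsD: "a # p \<in> P_set \<Longrightarrow> p \<in> P_set"
  unfolding P_set_def integer_partitions_def
  by (auto simp: sublist_Cons_right split: if_splits)

lemma adj_if_P_set:
  assumes "a # b # p \<in> P_set"
  shows "adj a b"
proof -
  have "a \<le> b" "b \<noteq> a + 1"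
    using assms by (auto simp: P_set_def integer_partitions_def sublist_Cons_right)
  moreover have "odd a" if "b = a"
  proof (rule ccontr)
    assume "\<not> odd a"
    then have "count_list (a # b # p) a \<le> 1"
      using assms unfolding P_set_def by blast
    then show False using that by simp
  qed
  ultimately show ?thesis by (auto simp: adj_def)
qed

lemma tri_if_P_set:
  assumes "a # b # c # p \<in> P_set"
  shows "tri a b c"
proof -
  let ?p = "a # b # c # p"
  have sub: "sublist [a, b, c] ?p" by (simp add: sublist_Cons_right)
  have le: "a \<le> b" "b \<le> c"
    using assms by (auto simp: P_set_def integer_partitions_def)
  have 3: "\<not> sublist [2*j+1, 2*j+1, 2*j+1+t] ?p" if "t \<le> 3" for j t
    using assms that unfolding P_set_def by blast
  have 4: "\<not> sublist [a', 2*j+1, 2*j+1] ?p" if "t \<le> 2" "a' + t = 2*j+1" for j t a'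
    using assms that unfolding P_set_def by blast
  have 5: "\<not> sublist [2*j+1, 2*j+3, 2*j+5] ?p" for j
    using assms unfolding P_set_def by blast
  show ?thesis
    unfolding tri_def
  proof (intro conjI notI; elim conjE)
    assume "odd a" "b = a" "c \<le> a + 3"
    moreover from \<open>odd a\<close> obtain j where "a = 2*j+1" by (elim oddE)
    \<comment> \<open>The witness for (iii) is \<open>t = c - a\<close>; sortedness makes the
      subtraction exact. For (iv) below it is \<open>b - a\<close>.\<close>
    ultimately show False using 3[of "c - a" j] sub le by (simp add: le_diff_conv)
  next
    assume "odd b" "c = b" "b \<le> a + 2"
    moreover from \<open>odd b\<close> obtain j where "b = 2*j+1" by (elim oddE)
    ultimately show False using 4[of "b - a" a j] sub le by (simp add: le_diff_conv)
  next
    assume "odd a" "b = a + 2" "c = a + 4"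
    moreover from \<open>odd a\<close> obtain j where "a = 2*j+1" by (elim oddE)
    ultimately show False using 5[of j] sub by (simp add: eval_nat_numeral)
  qed
qed

lemma admissible_if_P_set: "p \<in> P_set \<Longrightarrow> admissible p"
  by (induction p rule: admissible.induct) (auto dest: P_set_ConsD adj_if_P_set tri_if_P_set)

lemma P_set_eq: "P_set = parts_ge 1"
proof (intro equalityI subsetI)
  fix p assume "p \<in> P_set"
  then show "p \<in> parts_ge 1"
    using admissible_if_P_set[of p]
    by (auto simp: parts_ge_def P_set_def integer_partitions_def Suc_le_eq)
next
  fix p assume "p \<in> parts_ge 1"
  then have admissible: "admissible p" and pos: "\<forall>a\<in>set p. 0 < a" by (auto simp: parts_ge_def)
  have "b \<noteq> a + 1" if "sublist [a, b] p" for a b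
    using admissible_sublist2[OF admissible that] by (auto simp: adj_def)
  moreover have "\<not> sublist [2*j+1, 2*j+1, 2*j+1+t] p" if "t \<le> 3" for j t
    using admissible_sublist3[OF admissible, of "2*j+1" "2*j+1" "2*j+1+t"] that by (auto simp: tri_def)
  moreover have "\<not> sublist [a, 2*j+1, 2*j+1] p" if "t \<le> 2" "a + t = 2*j+1" for j t a
    using admissible_sublist3[OF admissible, of a "2*j+1" "2*j+1"] that by (auto simp: tri_def)
  moreover have "\<not> sublist [2*j+1, 2*j+3, 2*j+5] p" for j
    using admissible_sublist3[OF admissible, of "2*j+1" "2*j+3" "2*j+5"] by (auto simp: tri_def)
  ultimately show "p \<in> P_set"
    unfolding P_set_def integer_partitions_def
    using admissible_sorted[OF admissible] pos admissible_even_count[OF admissible] by blast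
qed

lemma P'_set_eq: "P'_set = parts_ge 2"
  unfolding P'_set_def P_set_eq
  by (auto simp: parts_ge_def numeral_2_eq_2 Suc_le_eq) (metis Suc_lessI)

section \<open>Even shifts and removal of the smallest part\<close>

lemma admissible_shift: "even c \<Longrightarrow> admissible (map ((+) c) p) = admissible p"
  by (induction p rule: admissible.induct) (auto simp: adj_def tri_def)

text \<open>\<open>adj\<close> and \<open>tri\<close> depend only on parities and differences, which
  an even shift preserves. Subtracting \<open>c\<close> is exact because every part is at least
  \<open>c\<close>.\<close>

lemma parts_ge_shift:
  assumes "even c"
  shows "parts_ge (c + k) = map ((+) c) ` parts_ge k"
proof (intro equalityI subsetI)
  fix p assume p: "p \<in> parts_ge (c + k)"
  define r where "r = map (\<lambda>a. a - c) p"
  have "p = map ((+) c) r"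
    unfolding r_def using p by (force simp: parts_ge_def intro: map_idI[symmetric])
  then show "p \<in> map ((+) c) ` parts_ge k"
    using p assms by (auto simp: parts_ge_def admissible_shift)
qed (auto simp: parts_ge_def admissible_shift[OF assms])

text \<open>After 2, a further 2 violates (ii) and a 3 violates (i). If the next part is at least 4,
  only (iv) could still fail at the front, and it would need an odd second part of size at most
  4.\<close>

lemma admissible_2_Cons: "admissible (2 # p) \<longleftrightarrow> p \<in> parts_ge 4"
proof (cases "2 # p" rule: admissible.cases)
  case (4 a b c r)
  then show ?thesis by (auto simp: Cons_in_parts_ge adj_def tri_def)
qed (auto simp: parts_ge_def adj_def)

lemma parts_ge_Suc_eq:
  "parts_ge k = parts_ge (Suc k) \<union> (#) k ` {p. admissible (k # p)}"
proof (intro equalityI subsetI)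
  fix p assume p: "p \<in> parts_ge k"
  show "p \<in> parts_ge (Suc k) \<union> (#) k ` {p. admissible (k # p)}"
  proof (cases p)
    case Nil
    then show ?thesis by (simp add: parts_ge_def)
  next
    case (Cons a r)
    then show ?thesis using p by (cases "a = k") (auto simp: Cons_in_parts_ge)
  qed
next
  fix p assume "p \<in> parts_ge (Suc k) \<union> (#) k ` {p. admissible (k # p)}"
  then show "p \<in> parts_ge k"
    by (auto simp: parts_ge_def dest: admissible_Cons_le)
qed

lemma parts_ge_2: "parts_ge 2 = parts_ge 3 \<union> (#) 2 ` parts_ge 4"
  using parts_ge_Suc_eq[of 2] by (simp add: admissible_2_Cons)

text \<open>Every forbidden pattern starting at \<open>a\<close> has its second part at most
  \<open>a + 2\<close>.\<close>

lemma admissible_Cons_gap: "a + 3 \<le> b \<Longrightarrow> admissible (a # b # p) \<longleftrightarrow> admissible (b # p)"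
  by (cases p) (auto simp: adj_def tri_def)

text \<open>Case split on the second part. After 1+1, (iii) forces the next part to be at least 5.
  After 1+3, a next part 3, 4 or 5 is excluded by (iv), (i), (v) respectively. A second part of at
  least 4 is unconstrained by the leading 1.\<close>

lemma admissible_1_Cons:
  "admissible (1 # p) \<longleftrightarrow> p \<in> parts_ge 4 \<union> (#) 3 ` parts_ge 6 \<union> (#) 1 ` parts_ge 5"
proof (cases "1 # p" rule: admissible.cases)
  case (3 a b)
  then have "p = [b]" by simp
  then show ?thesis by (auto simp: Cons_in_parts_ge adj_def image_iff parts_ge_def[of 6] parts_ge_def[of 5])
next
  case (4 a b c r)
  then have p: "p = b # c # r" by simp
  consider "b = 0 \<or> b = 2" | "b = 1" | "b = 3" | "4 \<le> b" by linarith
  then show ?thesis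
  proof cases
    case 1
    then show ?thesis by (auto simp: p Cons_in_parts_ge adj_def)
  next
    case 2
    have "admissible (1 # p) \<longleftrightarrow> 5 \<le> c \<and> admissible (c # r)"
      using 2 admissible_Cons_gap[of 1 c r] by (auto simp: p adj_def tri_def dest: admissible_tl)
    then show ?thesis using 2 by (auto simp: p Cons_in_parts_ge)
  next
    case 3
    have "6 \<le> c" if "admissible (1 # p)"
    proof -
      have "tri 1 3 c" "adj 3 c"
        using that 3 by (cases r; simp add: p)+
      then show ?thesis by (auto simp: tri_def adj_def)
    qed
    moreover have "admissible (1 # p)" if "6 \<le> c" "admissible (c # r)"
    proof -
      have "admissible (3 # c # r)" using that admissible_Cons_gap[of 3 c r] by simp
      moreover have "tri 1 3 c" "adj 1 3" using that by (simp_all add: tri_def adj_def)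
      ultimately show ?thesis unfolding p 3 by simp
    qed
    ultimately have "admissible (1 # p) \<longleftrightarrow> 6 \<le> c \<and> admissible (c # r)"
      unfolding p using admissible_tl by blast
    then show ?thesis using 3 by (auto simp: p Cons_in_parts_ge)
  next
    case 4
    then show ?thesis using admissible_Cons_gap[of 1 b "c # r"] by (auto simp: p Cons_in_parts_ge)
  qed
qed (auto simp: parts_ge_def)

lemma parts_ge_1:
  "parts_ge 1 = parts_ge 2 \<union> (#) 1 ` (parts_ge 4 \<union> (#) 3 ` parts_ge 6 \<union> (#) 1 ` parts_ge 5)"
  using parts_ge_Suc_eq[of 1] unfolding admissible_1_Cons Collect_mem_eq by (simp add: numeral_2_eq_2)

section \<open>Sums of formal power series graded by the power of x\<close>

text \<open>A coefficient of the partial sums is constant once the finitely many indices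
  contributing to it are included, which is convergence in this topology.\<close>

lemma has_sum_fpsI:
  fixes f :: "'i \<Rightarrow> 'a :: ab_group_add fps"
  assumes fin: "\<And>m. finite {p \<in> A. f p $ m \<noteq> 0}"
    and S: "\<And>m. S $ m = (\<Sum>p | p \<in> A \<and> f p $ m \<noteq> 0. f p $ m)"
  shows "(f has_sum S) A"
  unfolding has_sum_def
proof (rule tendsto_fpsI)
  fix m
  have "(\<Sum>p\<in>F. f p $ m) = S $ m" if "finite F" "{p \<in> A. f p $ m \<noteq> 0} \<subseteq> F" "F \<subseteq> A" for F
    unfolding S by (rule sum.mono_neutral_right) (use that in auto)
  then show "\<forall>\<^sub>F F in finite_subsets_at_top A. sum f F $ m = S $ m"
    unfolding eventually_finite_subsets_at_top fps_sum_nth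
    by (intro exI[of _ "{p \<in> A. f p $ m \<noteq> 0}"]) (use fin in auto)
qed

text \<open>The limit is written in terms of \<open>F\<close> alone, where \<open>F n\<close>
  collects the terms of degree n in x. Hence two families with the same \<open>F\<close> have the
  same sum, even over different index sets; this is how partitions are compared with
  triples.\<close>

lemma has_sum_graded:
  fixes c :: "'i \<Rightarrow> rat fps fps"
  assumes fin: "\<And>m. finite {p \<in> A. c p $ m \<noteq> 0}"
    and F: "\<And>n m. F n $ m = (\<Sum>p | p \<in> A \<and> c p $ m \<noteq> 0 \<and> d p = n. c p $ m)"
  shows "((\<lambda>p. var_x ^ d p * c p) has_sum
    Abs_fps (\<lambda>m. \<Sum>n | F n $ m \<noteq> 0. fps_X ^ n * F n $ m)) A"
proof -
  have coeff: "(var_x ^ d p * c p) $ m = fps_X ^ d p * c p $ m" for p m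
    by (simp add: var_x_def fps_const_power)
  have "(\<Sum>n | F n $ m \<noteq> 0. fps_X ^ n * F n $ m)
      = (\<Sum>p | p \<in> A \<and> c p $ m \<noteq> 0. fps_X ^ d p * c p $ m)" (is "?l = ?r") for m
  proof -
    let ?B = "{p \<in> A. c p $ m \<noteq> 0}"
    \<comment> \<open>The sum over n may thus run over the finite set of degrees that occur; degrees
      whose terms cancel only add zeros.\<close>
    have "F n $ m = 0" if "n \<notin> d ` ?B" for n
      unfolding F using that by (intro sum.neutral) auto
    then have "?l = (\<Sum>n\<in>d ` ?B. fps_X ^ n * F n $ m)"
      by (intro sum.mono_neutral_left) (use fin in auto)
    also have "\<dots> = (\<Sum>n\<in>d ` ?B. \<Sum>p | p \<in> ?B \<and> d p = n. fps_X ^ d p * c p $ m)"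
      unfolding F sum_distrib_left by (intro sum.cong) auto
    also have "\<dots> = ?r"
      by (subst sum.group) (use fin in auto)
    finally show ?thesis .
  qed
  then show ?thesis
    by (intro has_sum_fpsI) (use fin in \<open>auto simp: coeff\<close>)
qed

section \<open>Generating functions by number of parts\<close>

definition slice :: "nat list set \<Rightarrow> nat \<Rightarrow> nat \<Rightarrow> nat list set" where
  "slice X n m = {p \<in> X. length p = n \<and> sum_list p = m}"

text \<open>The coefficient of \<open>x\<^sup>n\<close>, as a series in \<open>q\<close> with constant coefficients.\<close>

definition GF :: "nat list set \<Rightarrow> nat \<Rightarrow> rat fps fps" where
  "GF X n = Abs_fps (\<lambda>m. of_nat (card (slice X n m)))"

lemma finite_slice: "finite (slice X n m)"
proof (rule finite_subset)
  show "slice X n m \<subseteq> {p. set p \<subseteq> {..m} \<and> length p = n}"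
    by (auto simp: slice_def member_le_sum_list)
qed (simp add: finite_lists_length_eq)

lemma GF_Un: "X \<inter> Y = {} \<Longrightarrow> GF (X \<union> Y) n = GF X n + GF Y n"
proof (rule fps_ext)
  fix m assume "X \<inter> Y = {}"
  then have "slice (X \<union> Y) n m = slice X n m \<union> slice Y n m" "slice X n m \<inter> slice Y n m = {}"
    by (auto simp: slice_def)
  then show "GF (X \<union> Y) n $ m = (GF X n + GF Y n) $ m"
    by (simp add: GF_def card_Un_disjoint finite_slice)
qed

lemma GF_Cons: "GF ((#) a ` X) (Suc n) = var_q ^ a * GF X n"
proof (rule fps_ext)
  fix m
  have "slice ((#) a ` X) (Suc n) m = (if a \<le> m then (#) a ` slice X n (m - a) else {})"
    by (auto simp: slice_def image_iff)
  then show "GF ((#) a ` X) (Suc n) $ m = (var_q ^ a * GF X n) $ m"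
    by (simp add: GF_def var_q_def fps_X_power_mult_nth card_image)
qed

lemma sum_list_shift: "sum_list (map ((+) c) p) = c * length p + sum_list (p :: nat list)"
  by (induction p) auto

lemma GF_shift: "GF (map ((+) c) ` X) n = var_q ^ (c * n) * GF X n"
proof (rule fps_ext)
  fix m
  have "slice (map ((+) c) ` X) n m = (if c * n \<le> m then map ((+) c) ` slice X n (m - c * n) else {})"
    by (auto simp: slice_def image_iff sum_list_shift)
  then show "GF (map ((+) c) ` X) n $ m = (var_q ^ (c * n) * GF X n) $ m"
    by (simp add: GF_def var_q_def fps_X_power_mult_nth card_image inj_on_def)
qed

lemma GF_0: "[] \<in> X \<Longrightarrow> GF X 0 = 1"
proof (rule fps_ext)
  fix m assume "[] \<in> X"
  then have "slice X 0 m = (if m = 0 then {[]} else {})" by (auto simp: slice_def)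
  then show "GF X 0 $ m = 1 $ m" by (simp add: GF_def)
qed

lemma has_sum_GF:
  assumes "\<And>p a. p \<in> X \<Longrightarrow> a \<in> set p \<Longrightarrow> 0 < a"
  shows "((\<lambda>p. var_x ^ length p * var_q ^ sum_list p) has_sum
    Abs_fps (\<lambda>m. \<Sum>n | GF X n $ m \<noteq> 0. fps_X ^ n * GF X n $ m)) X"
proof (rule has_sum_graded)
  fix m
  \<comment> \<open>Positive parts bound the length by the size, so each power of q receives
    finitely many partitions.\<close>
  have "length p \<le> sum_list p" if "\<And>a. a \<in> set p \<Longrightarrow> 0 < a" for p :: "nat list"
    using that
  proof (induction p)
    case (Cons a p)
    then have "length p \<le> sum_list p" "0 < a" by simp_all
    then show ?case by simp
  qed simp
  then have "{p \<in> X. (var_q ^ sum_list p) $ m \<noteq> 0} \<subseteq> (\<Union>n\<le>m. slice X n m)"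
    using assms by (auto simp: slice_def var_q_def)
  then show "finite {p \<in> X. (var_q ^ sum_list p) $ m \<noteq> 0}"
    by (rule finite_subset) (simp add: finite_slice)
next
  fix n m
  have "{p. p \<in> X \<and> (var_q ^ sum_list p) $ m \<noteq> 0 \<and> length p = n} = slice X n m"
    by (auto simp: slice_def var_q_def)
  then show "GF X n $ m =
      (\<Sum>p | p \<in> X \<and> (var_q ^ sum_list p) $ m \<noteq> 0 \<and> length p = n. (var_q ^ sum_list p) $ m)"
    by (simp add: GF_def var_q_def slice_def)
qed

section \<open>Recurrences for the partition generating functions\<close>

lemma GF_parts_ge_shift:
  "even c \<Longrightarrow> GF (parts_ge (c + k)) n = var_q ^ (c * n) * GF (parts_ge k) n"
  by (simp add: parts_ge_shift GF_shift)

lemma GF_parts_ge_simps: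
  "GF (parts_ge 3) n = var_q ^ (2*n) * GF (parts_ge 1) n"
  "GF (parts_ge 4) n = var_q ^ (2*n) * GF (parts_ge 2) n"
  "GF (parts_ge 5) n = var_q ^ (4*n) * GF (parts_ge 1) n"
  "GF (parts_ge 6) n = var_q ^ (4*n) * GF (parts_ge 2) n"
  using GF_parts_ge_shift[of 2 1 n] GF_parts_ge_shift[of 2 2 n]
    GF_parts_ge_shift[of 4 1 n] GF_parts_ge_shift[of 4 2 n] by (simp_all del: One_nat_def)

lemma GF_parts_ge_0: "GF (parts_ge k) 0 = 1"
  by (rule GF_0) (simp add: parts_ge_def)

lemma GF_parts_ge_2_Suc:
  "GF (parts_ge 2) (Suc n) =
    var_q ^ (2 * Suc n) * (GF (parts_ge 1) (Suc n) + GF (parts_ge 2) n)"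
proof -
  have "GF (parts_ge 2) (Suc n) = GF (parts_ge 3) (Suc n) + GF ((#) 2 ` parts_ge 4) (Suc n)"
    by (subst parts_ge_2, rule GF_Un) (auto simp: Cons_in_parts_ge)
  moreover have "var_q ^ (2 * Suc n) = var_q ^ 2 * var_q ^ (2*n)"
    by (simp flip: power_add)
  ultimately show ?thesis
    by (simp only: GF_Cons GF_parts_ge_simps distrib_left mult.assoc)
qed

lemma GF_parts_ge_1_split:
  "GF (parts_ge 1) n = GF (parts_ge 2) n +
    GF ((#) 1 ` (parts_ge 4 \<union> (#) 3 ` parts_ge 6 \<union> (#) 1 ` parts_ge 5)) n"
  by (subst parts_ge_1, rule GF_Un) (auto simp: Cons_in_parts_ge)

lemma GF_tails_split:
  "GF (parts_ge 4 \<union> (#) 3 ` parts_ge 6 \<union> (#) 1 ` parts_ge 5) n =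
    GF (parts_ge 4) n + GF ((#) 3 ` parts_ge 6) n + GF ((#) 1 ` parts_ge 5) n"
proof -
  have "(parts_ge 4 \<union> (#) 3 ` parts_ge 6) \<inter> (#) 1 ` parts_ge 5 = {}"
    "parts_ge 4 \<inter> (#) 3 ` parts_ge 6 = {}"
    by (auto simp: Cons_in_parts_ge)
  then show ?thesis by (simp add: GF_Un)
qed

text \<open>A single part 1 leaves the empty tail, so the terms for a second part 1 or 3 are absent
  and this case is separate.\<close>

lemma GF_parts_ge_1_1:
  "GF (parts_ge 1) 1 = GF (parts_ge 2) 1 + var_q * GF (parts_ge 2) 0"
proof -
  let ?T = "parts_ge 4 \<union> (#) 3 ` parts_ge 6 \<union> (#) 1 ` parts_ge 5"
  have "GF ?T 0 = 1" by (rule GF_0) (simp add: parts_ge_def)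
  then have "GF ((#) 1 ` ?T) 1 = var_q" using GF_Cons[of 1 ?T 0] by simp
  then show ?thesis by (simp only: GF_parts_ge_1_split[of 1] GF_parts_ge_0 mult_1_right)
qed

lemma GF_parts_ge_1_SucSuc:
  "GF (parts_ge 1) (Suc (Suc n)) = GF (parts_ge 2) (Suc (Suc n))
    + var_q ^ (2*n + 3) * GF (parts_ge 2) (Suc n)
    + var_q ^ (4*n + 4) * GF (parts_ge 2) n + var_q ^ (4*n + 2) * GF (parts_ge 1) n"
proof -
  \<comment> \<open>Each exponent is the sum of the removed parts (1, then 1+3, then 1+1) plus the
    shift of the remaining ones.\<close>
  have e: "2*n + 3 = 1 + 2 * Suc n" "4*n + 4 = 1 + (3 + 4*n)" "4*n + 2 = 1 + (1 + 4*n)"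
    by simp_all
  show ?thesis
    unfolding e power_add
    by (simp only: GF_parts_ge_1_split[of "Suc (Suc n)"] GF_Cons GF_tails_split GF_parts_ge_simps
        distrib_left mult.assoc add.assoc)
qed

text \<open>Earlier values determine \<open>a n - b n\<close>. For two solutions agreeing so far,
  the equation for \<open>b\<close> then gives \<open>(1 - q ^ (2*n)) * (a n - a' n) = 0\<close> for
  positive n, and the first factor is nonzero.\<close>

lemma system_unique:
  fixes q :: "'a :: idom" and a b a' b' :: "nat \<Rightarrow> 'a"
  assumes q: "\<And>n. q ^ (2 * Suc n) \<noteq> 1"
    and a0: "a 0 = a' 0" and b0: "b 0 = b' 0"
    and a: "a 1 = b 1 + q * b 0"
      "\<And>n. a (Suc (Suc n)) = b (Suc (Suc n)) + q ^ (2*n + 3) * b (Suc n)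
        + q ^ (4*n + 4) * b n + q ^ (4*n + 2) * a n"
    and b: "\<And>n. b (Suc n) = q ^ (2 * Suc n) * (a (Suc n) + b n)"
    and a': "a' 1 = b' 1 + q * b' 0"
      "\<And>n. a' (Suc (Suc n)) = b' (Suc (Suc n)) + q ^ (2*n + 3) * b' (Suc n)
        + q ^ (4*n + 4) * b' n + q ^ (4*n + 2) * a' n"
    and b': "\<And>n. b' (Suc n) = q ^ (2 * Suc n) * (a' (Suc n) + b' n)"
  shows "a n = a' n \<and> b n = b' n"
proof (induction n rule: less_induct)
  case (less n)
  have solve: "a (Suc m) = a' (Suc m) \<and> b (Suc m) = b' (Suc m)"
    if "a (Suc m) - b (Suc m) = a' (Suc m) - b' (Suc m)" "b m = b' m" for m
  proof -
    have "a (Suc m) - a' (Suc m) = b (Suc m) - b' (Suc m)"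
      using that(1) by (simp add: algebra_simps)
    also have "\<dots> = q ^ (2 * Suc m) * (a (Suc m) - a' (Suc m))"
      unfolding b b' that(2) by (simp add: algebra_simps)
    finally have "(1 - q ^ (2 * Suc m)) * (a (Suc m) - a' (Suc m)) = 0"
      by (simp add: algebra_simps)
    then have "a (Suc m) = a' (Suc m)" using q[of m] by simp
    then show ?thesis using b b' that(2) by simp
  qed
  consider "n = 0" | "n = 1" | m where "n = Suc (Suc m)"
    by (metis One_nat_def not0_implies_Suc)
  then show ?case
  proof cases
    case 1
    then show ?thesis using a0 b0 by simp
  next
    case 2
    then show ?thesis using solve[of 0] a(1) a'(1) b0 by simp
  next
    case 3
    have "a m = a' m" "b m = b' m" "b (Suc m) = b' (Suc m)" using less 3 by simp_all
    then show ?thesis using 3 solve[of "Suc m"] a(2)[of m] a'(2)[of m] by simp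
  qed
qed

section \<open>The triple sums\<close>

text \<open>The coefficient ring \<open>rat fps\<close> is not a field; constant term 1 suffices
  because \<open>inverse 1 = 1\<close> there.\<close>

lemma fps_inverse_left:
  fixes f :: "rat fps fps"
  assumes "f $ 0 = 1"
  shows "inverse f * f = 1"
proof -
  have "inverse (1 :: rat fps) = 1" by simp
  then show ?thesis
    unfolding fps_inverse_def[of f] using assms fps_left_inverse'[of 1 f 1] by simp
qed

lemma fps_divide_eq:
  fixes f g :: "rat fps fps"
  assumes "g $ 0 = 1"
  shows "f / g = f * inverse g"
  using assms by (intro fps_divide_unit) simp

lemma fps_inverse_mult_unital:
  fixes f g :: "rat fps fps"
  assumes "f $ 0 = 1" "g $ 0 = 1"
  shows "inverse (f * g) = inverse f * inverse g"
proof -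
  have "inverse (f * g) = inverse (f * g) * (inverse f * f) * (inverse g * g)"
    using assms by (simp add: fps_inverse_left)
  also have "\<dots> = (inverse (f * g) * (f * g)) * (inverse f * inverse g)"
    by (simp only: ac_simps)
  also have "\<dots> = inverse f * inverse g"
    using assms by (simp add: fps_inverse_left)
  finally show ?thesis .
qed

section \<open>Reciprocal q-Pochhammer symbols and the weights of triples\<close>

definition inv_qpoch :: "nat \<Rightarrow> nat \<Rightarrow> rat fps fps" where
  "inv_qpoch d n = inverse (qpoch (var_q ^ d) (var_q ^ d) n)"

lemma qpoch_Suc: "qpoch a q (Suc n) = qpoch a q n * (1 - a * q ^ n)"
  by (simp add: qpoch_def)

lemma var_q_power_nth_0: "d > 0 \<Longrightarrow> (var_q ^ d) $ 0 = 0"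
  by (simp add: var_q_def)

lemma qpoch_nth_0:
  assumes "d > 0"
  shows "qpoch (var_q ^ d) (var_q ^ d) n $ 0 = 1"
  by (induction n) (use assms in \<open>simp_all add: qpoch_def fps_mult_nth_0 var_q_power_nth_0\<close>)

lemma inv_qpoch_Suc:
  assumes "d > 0"
  shows "inv_qpoch d (Suc n) * (1 - var_q ^ (d * Suc n)) = inv_qpoch d n"
proof -
  let ?g = "1 - var_q ^ d * (var_q ^ d) ^ n :: rat fps fps"
  have g: "?g = 1 - var_q ^ (d * Suc n)" by (simp add: power_add power_mult)
  have "?g $ 0 = 1" using assms by (simp add: fps_mult_nth_0 var_q_power_nth_0)
  then have "inv_qpoch d (Suc n) * ?g = inv_qpoch d n * (inverse ?g * ?g)"
    unfolding inv_qpoch_def qpoch_Suc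
    by (simp only: fps_inverse_mult_unital qpoch_nth_0[OF assms] mult.assoc)
  also have "inverse ?g * ?g = 1" by (rule fps_inverse_left) fact
  finally show ?thesis unfolding g by simp
qed

lemma inv_qpoch_0: "inv_qpoch d 0 = 1"
  using fps_inverse_left[of 1] by (simp add: inv_qpoch_def qpoch_def)

text \<open>The factor common to both triple sums; the powers of q in which they differ enter
  through the argument \<open>f\<close> of \<open>wsum\<close>.\<close>

definition wt :: "nat \<Rightarrow> nat \<Rightarrow> nat \<Rightarrow> rat fps fps" where
  "wt i j k = (-1) ^ k * var_q ^ (3 * k\<^sup>2) * (inv_qpoch 1 i * inv_qpoch 4 j * inv_qpoch 6 k)"

lemma wt_Suc_i: "(1 - var_q ^ Suc i) * wt (Suc i) j k = wt i j k"
  using inv_qpoch_Suc[of 1 i, symmetric] by (simp add: wt_def ac_simps del: power_Suc)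

lemma wt_Suc_j: "(1 - var_q ^ (4 * Suc j)) * wt i (Suc j) k = wt i j k"
  using inv_qpoch_Suc[of 4 j, symmetric] by (simp add: wt_def ac_simps del: power_Suc mult_Suc_right)

text \<open>Besides the cancelled Pochhammer factor, raising k flips the sign and adds 3(k+1)^2 -
  3k^2 = 6k + 3 to the exponent.\<close>

lemma wt_Suc_k: "(1 - var_q ^ (6 * Suc k)) * wt i j (Suc k) = - (var_q ^ (6*k + 3) * wt i j k)"
proof -
  have "3 * (Suc k)\<^sup>2 = 3 * k\<^sup>2 + (6 * k + 3)" by (simp add: power2_eq_square)
  then have "(1 - var_q ^ (6 * Suc k)) * wt i j (Suc k) = - ((-1) ^ k * var_q ^ (3 * k\<^sup>2) * var_q ^ (6*k + 3)
      * (inv_qpoch 1 i * inv_qpoch 4 j * (inv_qpoch 6 (Suc k) * (1 - var_q ^ (6 * Suc k)))))"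
    by (simp add: wt_def ac_simps power_add del: mult_Suc_right)
  then show ?thesis
    by (simp only: inv_qpoch_Suc) (simp add: wt_def ac_simps)
qed

section \<open>Sums over triples with fixed N, and index shifts\<close>

definition tris :: "nat \<Rightarrow> (nat \<times> nat \<times> nat) set" where
  "tris n = {(i, j, k). i + 2*j + 3*k = n}"

definition wsum :: "(nat \<Rightarrow> nat \<Rightarrow> nat \<Rightarrow> rat fps fps) \<Rightarrow> nat \<Rightarrow> rat fps fps" where
  "wsum f n = (\<Sum>(i, j, k)\<in>tris n. f i j k * wt i j k)"

lemma finite_tris: "finite (tris n)"
  by (rule finite_subset[of _ "{..n} \<times> {..n} \<times> {..n}"]) (auto simp: tris_def)

lemma wsum_cong: "(\<And>i j k. i + 2*j + 3*k = n \<Longrightarrow> f i j k = g i j k) \<Longrightarrow> wsum f n = wsum g n"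
  unfolding wsum_def by (intro sum.cong) (auto simp: tris_def)

lemma wsum_add: "wsum (\<lambda>i j k. f i j k + g i j k) n = wsum f n + wsum g n"
  by (simp add: wsum_def ring_distribs sum.distrib case_prod_unfold)

lemma wsum_cmult: "wsum (\<lambda>i j k. c * f i j k) n = c * wsum f n"
  by (simp add: wsum_def sum_distrib_left case_prod_unfold mult.assoc)

lemma wsum_diff: "wsum (\<lambda>i j k. f i j k - g i j k) n = wsum f n - wsum g n"
  by (simp add: wsum_def ring_distribs sum_subtractf case_prod_unfold)

lemma wsum_0: "wsum f 0 = f 0 0 0"
proof -
  have "tris 0 = {(0, 0, 0)}" by (auto simp: tris_def)
  then show ?thesis by (simp add: wsum_def wt_def inv_qpoch_0)
qed

lemma sum_tris_shift:
  fixes h :: "nat \<times> nat \<times> nat \<Rightarrow> rat fps fps"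
  assumes "inj_on s (tris n)" "s ` tris n \<subseteq> tris m" "\<And>t. t \<in> tris m - s ` tris n \<Longrightarrow> h t = 0"
  shows "sum h (tris m) = (\<Sum>t\<in>tris n. h (s t))"
proof -
  have "sum h (tris m) = sum h (s ` tris n)"
    by (rule sum.mono_neutral_right) (use assms finite_tris in auto)
  then show ?thesis using assms(1) by (simp add: sum.reindex)
qed

text \<open>The factor 1 - q^i kills the terms with i = 0 and otherwise cancels the last factor of
  (q;q)_i, so replacing i by i + 1 lowers N by one. The shifts in j and k follow the same pattern
  and lower N by 2 and 3.\<close>

lemma wsum_shift_i:
  "wsum (\<lambda>i j k. f i j k * (1 - var_q ^ i)) (Suc n) =
    wsum (\<lambda>i j k. f (Suc i) j k) n"
proof -
  let ?s = "\<lambda>(i, j, k). (Suc i, j, k)"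
  have zero: "f i j k * (1 - var_q ^ i) * wt i j k = 0"
    if "(i, j, k) \<in> tris (Suc n) - ?s ` tris n" for i j k
  proof (cases i)
    case 0
    then show ?thesis by simp
  next
    case (Suc l)
    then have "(i, j, k) = ?s (l, j, k)" "(l, j, k) \<in> tris n"
      using that by (auto simp: tris_def)
    then show ?thesis using that by blast
  qed
  have "wsum (\<lambda>i j k. f i j k * (1 - var_q ^ i)) (Suc n) =
      (\<Sum>t\<in>tris n. case ?s t of (i, j, k) \<Rightarrow> f i j k * (1 - var_q ^ i) * wt i j k)"
    unfolding wsum_def
  proof (rule sum_tris_shift)
    show "inj_on ?s (tris n)" by (auto simp: inj_on_def)
    show "?s ` tris n \<subseteq> tris (Suc n)" by (auto simp: tris_def)
  qed (simp only: split_paired_all case_prod_conv, rule zero)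
  also have "\<dots> = wsum (\<lambda>i j k. f (Suc i) j k) n"
    unfolding wsum_def
    by (rule sum.cong[OF refl]) (simp only: split_paired_all case_prod_conv mult.assoc wt_Suc_i mult_minus_right)
  finally show ?thesis .
qed

lemma wsum_shift_j:
  "wsum (\<lambda>i j k. f i j k * (1 - var_q ^ (4*j))) (Suc (Suc n)) =
    wsum (\<lambda>i j k. f i (Suc j) k) n"
proof -
  let ?s = "\<lambda>(i, j, k). (i, Suc j, k)"
  have zero: "f i j k * (1 - var_q ^ (4*j)) * wt i j k = 0"
    if "(i, j, k) \<in> tris (Suc (Suc n)) - ?s ` tris n" for i j k
  proof (cases j)
    case 0
    then show ?thesis by simp
  next
    case (Suc l)
    then have "(i, j, k) = ?s (i, l, k)" "(i, l, k) \<in> tris n"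
      using that by (auto simp: tris_def)
    then show ?thesis using that by blast
  qed
  have "wsum (\<lambda>i j k. f i j k * (1 - var_q ^ (4*j))) (Suc (Suc n)) =
      (\<Sum>t\<in>tris n. case ?s t of (i, j, k) \<Rightarrow> f i j k * (1 - var_q ^ (4*j)) * wt i j k)"
    unfolding wsum_def
  proof (rule sum_tris_shift)
    show "inj_on ?s (tris n)" by (auto simp: inj_on_def)
    show "?s ` tris n \<subseteq> tris (Suc (Suc n))" by (auto simp: tris_def)
  qed (simp only: split_paired_all case_prod_conv, rule zero)
  also have "\<dots> = wsum (\<lambda>i j k. f i (Suc j) k) n"
    unfolding wsum_def
    by (rule sum.cong[OF refl]) (simp only: split_paired_all case_prod_conv mult.assoc wt_Suc_j mult_minus_right)
  finally show ?thesis .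
qed

lemma wsum_shift_k:
  "wsum (\<lambda>i j k. f i j k * (1 - var_q ^ (6*k))) (Suc (Suc (Suc n))) =
    - wsum (\<lambda>i j k. f i j (Suc k) * var_q ^ (6*k + 3)) n"
proof -
  let ?s = "\<lambda>(i, j, k). (i, j, Suc k)"
  have zero: "f i j k * (1 - var_q ^ (6*k)) * wt i j k = 0"
    if "(i, j, k) \<in> tris (Suc (Suc (Suc n))) - ?s ` tris n" for i j k
  proof (cases k)
    case 0
    then show ?thesis by simp
  next
    case (Suc l)
    then have "(i, j, k) = ?s (i, j, l)" "(i, j, l) \<in> tris n"
      using that by (auto simp: tris_def)
    then show ?thesis using that by blast
  qed
  have "wsum (\<lambda>i j k. f i j k * (1 - var_q ^ (6*k))) (Suc (Suc (Suc n))) =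
      (\<Sum>t\<in>tris n. case ?s t of (i, j, k) \<Rightarrow> f i j k * (1 - var_q ^ (6*k)) * wt i j k)"
    unfolding wsum_def
  proof (rule sum_tris_shift)
    show "inj_on ?s (tris n)" by (auto simp: inj_on_def)
    show "?s ` tris n \<subseteq> tris (Suc (Suc (Suc n)))" by (auto simp: tris_def)
  qed (simp only: split_paired_all case_prod_conv, rule zero)
  also have "\<dots> = - wsum (\<lambda>i j k. f i j (Suc k) * var_q ^ (6*k + 3)) n"
    unfolding wsum_def sum_negf[symmetric]
    by (rule sum.cong[OF refl]) (simp only: split_paired_all case_prod_conv mult.assoc wt_Suc_k mult_minus_right)
  finally show ?thesis .
qed

lemma wsum_eq_0: "(\<And>i j k. i + 2*j + 3*k = n \<Longrightarrow> f i j k = 0) \<Longrightarrow> wsum f n = 0"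
  unfolding wsum_def by (intro sum.neutral) (auto simp: tris_def)

text \<open>Boundary case of the shift in j: N is too small for a positive j.\<close>

lemma wsum_j_less: "n < 2 \<Longrightarrow> wsum (\<lambda>i j k. f i j k * (1 - var_q ^ (4*j))) n = 0"
proof (rule wsum_eq_0)
  fix i j k assume "n < 2" "i + 2*j + 3*k = n"
  then have "j = 0" by linarith
  then show "f i j k * (1 - var_q ^ (4*j)) = 0" by simp
qed

lemma wsum_k_less: "n < 3 \<Longrightarrow> wsum (\<lambda>i j k. f i j k * (1 - var_q ^ (6*k))) n = 0"
proof (rule wsum_eq_0)
  fix i j k assume "n < 3" "i + 2*j + 3*k = n"
  then have "k = 0" by linarith
  then show "f i j k * (1 - var_q ^ (6*k)) = 0" by simp
qed

section \<open>Recurrences for the triple sums\<close>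

definition wsum1 :: "nat \<Rightarrow> rat fps fps" where
  "wsum1 = wsum (\<lambda>i j k. 1)"

definition wsumq :: "nat \<Rightarrow> rat fps fps" where
  "wsumq = wsum (\<lambda>i j k. var_q ^ i)"

text \<open>The shift in i applied to \<open>f = 1\<close>; this will become the second equation of
  the system.\<close>

lemma wsum1_Suc: "wsum1 (Suc n) = wsumq (Suc n) + wsum1 n"
  using wsum_shift_i[of "\<lambda>i j k. 1" n] by (simp add: wsum1_def wsumq_def wsum_diff algebra_simps)

lemma wsum_q_shift_i: "wsum (\<lambda>i j k. var_q ^ i * (1 - var_q ^ i)) (Suc n) = var_q * wsumq n"
  using wsum_shift_i[of "\<lambda>i j k. var_q ^ i" n] by (simp add: wsumq_def wsum_cmult)

lemma wsum_q2_0: "wsum (\<lambda>i j k. var_q ^ (2*i)) 0 = 1"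
  by (simp add: wsum_0)

lemma wsum_q2_Suc: "wsum (\<lambda>i j k. var_q ^ (2*i)) (Suc n) = wsumq (Suc n) - var_q * wsumq n"
proof -
  have "wsum (\<lambda>i j k. var_q ^ (2*i)) (Suc n) =
      wsum (\<lambda>i j k. var_q ^ i - var_q ^ i * (1 - var_q ^ i)) (Suc n)"
    by (rule wsum_cong) (simp add: right_diff_distrib flip: power_add mult_2)
  then show ?thesis
    by (simp only: wsum_diff wsum_q_shift_i) (simp add: wsumq_def)
qed

text \<open>
  Since \<open>q\<^bsup>2n\<^esup> = q\<^bsup>2i+4j+6k\<^esup>\<close> on the summation range, the difference \<open>q\<^sup>i - q\<^bsup>2n\<^esup>\<close> telescopes through
  \<open>q\<^bsup>2i\<^esup>\<close> and \<open>q\<^bsup>2i+4j\<^esup>\<close>.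
\<close>

lemma wsumq_telescope:
  "wsumq n - var_q ^ (2*n) * wsum1 n = wsum (\<lambda>i j k. var_q ^ i * (1 - var_q ^ i)) n
    + wsum (\<lambda>i j k. var_q ^ (2*i) * (1 - var_q ^ (4*j))) n
    + wsum (\<lambda>i j k. var_q ^ (2*i + 4*j) * (1 - var_q ^ (6*k))) n"
  unfolding wsumq_def wsum1_def wsum_cmult[symmetric] wsum_diff[symmetric] wsum_add[symmetric]
proof (rule wsum_cong)
  fix i j k assume "i + 2*j + 3*k = n"
  then have "2*n = 2*i + 4*j + 6*k" by simp
  then have "var_q ^ (2*n) = var_q ^ (2*i) * var_q ^ (4*j) * var_q ^ (6*k)"
    by (simp only: power_add)
  moreover have "var_q ^ i * var_q ^ i = var_q ^ (2*i)"
    by (simp only: mult_2 power_add)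
  ultimately show "var_q ^ i - var_q ^ (2*n) * 1 = var_q ^ i * (1 - var_q ^ i)
      + var_q ^ (2*i) * (1 - var_q ^ (4*j)) + var_q ^ (2*i + 4*j) * (1 - var_q ^ (6*k))"
    by (simp add: right_diff_distrib power_add)
qed

lemma wsumq_0: "wsumq 0 = 1" and wsum1_0: "wsum1 0 = 1"
  by (simp_all add: wsumq_def wsum1_def wsum_0)

text \<open>Of the three telescoping differences only the one in i survives here; for n = 2 the one
  in j joins it, contributing 1.\<close>

lemma wsumq_1: "wsumq 1 = var_q\<^sup>2 * wsum1 1 + var_q * wsum1 0"
proof -
  have "wsumq 1 - var_q ^ (2*1) * wsum1 1 = var_q * wsumq 0"
    unfolding wsumq_telescope by (simp add: wsum_q_shift_i wsum_j_less wsum_k_less)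
  then show ?thesis by (simp add: wsumq_0 wsum1_0 algebra_simps power2_eq_square)
qed

lemma wsumq_2: "wsumq 2 = var_q ^ 4 * wsum1 2 + var_q * wsumq 1 + 1"
proof -
  have "wsumq (Suc (Suc 0)) - var_q ^ (2 * Suc (Suc 0)) * wsum1 (Suc (Suc 0)) = var_q * wsumq (Suc 0) + 1 + 0"
    unfolding wsumq_telescope wsum_q_shift_i wsum_shift_j wsum_q2_0
    by (subst wsum_k_less) simp_all
  moreover have "2 * Suc (Suc 0) = 4" by simp
  ultimately show ?thesis by (simp only: numeral_2_eq_2 One_nat_def diff_eq_eq) (simp add: ac_simps)
qed

text \<open>The three telescoping differences are shifted in i, j and k. The shift in j leaves a sum
  of q^(2i), reduced by \<open>wsum_q2_Suc\<close>; the shift in k leaves the exponent 2i + 4j + 6k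
  + 3, constantly 2n + 3 on the range.\<close>

lemma wsumq_3:
  "wsumq (n + 3) = var_q ^ (2*n + 6) * wsum1 (n + 3) + var_q * wsumq (n + 2)
    + wsumq (n + 1) - var_q * wsumq n - var_q ^ (2*n + 3) * wsum1 n"
proof -
  have "wsum (\<lambda>i j k. var_q ^ (2*i + 4*j) * var_q ^ (6*k + 3)) n =
      wsum (\<lambda>i j k. var_q ^ (2*n + 3) * 1) n"
  proof (rule wsum_cong)
    fix i j k assume "i + 2*j + 3*k = n"
    then have "2*n + 3 = (2*i + 4*j) + (6*k + 3)" by simp
    then show "var_q ^ (2*i + 4*j) * var_q ^ (6*k + 3) = var_q ^ (2*n + 3) * 1"
      by (simp only: power_add[symmetric] mult_1_right)
  qed
  then have k: "wsum (\<lambda>i j k. var_q ^ (2*i + 4*j) * var_q ^ (6*k + 3)) n = var_q ^ (2*n + 3) * wsum1 n"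
    unfolding wsum1_def wsum_cmult .
  let ?m = "Suc (Suc (Suc n))"
  have "wsumq ?m - var_q ^ (2 * ?m) * wsum1 ?m = var_q * wsumq (Suc (Suc n))
      + (wsumq (Suc n) - var_q * wsumq n) + - (var_q ^ (2*n + 3) * wsum1 n)"
    unfolding wsumq_telescope
    by (simp only: wsum_q_shift_i wsum_shift_j wsum_shift_k wsum_q2_Suc k)
  moreover have "?m = n + 3" "Suc (Suc n) = n + 2" "2 * ?m = 2*n + 6" by simp_all
  ultimately show ?thesis by (simp only: Suc_eq_plus1 diff_eq_eq) (simp add: ac_simps)
qed

text \<open>
  By the previous lemma, the difference of the two sides is \<open>q\<close> times the one for \<open>n - 1\<close>.
\<close>

lemma wsumq_SucSuc:
  "wsumq (n + 2) = var_q ^ (2*n + 4) * wsum1 (n + 2) + var_q ^ (2*n + 3) * wsum1 (n + 1)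
    + var_q ^ (2*n + 2) * wsum1 n + wsumq n"
proof (induction n)
  case 0
  show ?case
    using wsumq_1 wsumq_2 wsumq_0 wsum1_0
    by (simp add: algebra_simps eval_nat_numeral)
next
  case (Suc n)
  have "var_q * wsumq (n + 2) = var_q ^ (2*n + 5) * wsum1 (n + 2) + var_q ^ (2*n + 4) * wsum1 (n + 1)
      + var_q ^ (2*n + 3) * wsum1 n + var_q * wsumq n"
    unfolding Suc.IH by (simp add: algebra_simps power_add eval_nat_numeral)
  then show ?case
    using wsumq_3[of n] by (simp add: eval_nat_numeral)
qed

text \<open>
  The coefficients of \<open>x\<^sup>n\<close> in the two triple sums. In the second one, \<open>2i + 4j + 6k = 2n\<close> turns the
  exponent \<open>n(n-1) + 2i + 4j + 6k\<close> into \<open>n(n+1)\<close>.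
\<close>

definition sumA :: "nat \<Rightarrow> rat fps fps" where
  "sumA n = var_q ^ (n * (n - 1)) * wsumq n"

definition sumB :: "nat \<Rightarrow> rat fps fps" where
  "sumB n = var_q ^ (n * (n + 1)) * wsum1 n"

lemma var_q_power_neq_1: "var_q ^ (2 * Suc n) \<noteq> 1"
proof
  assume "var_q ^ (2 * Suc n) = 1"
  then have "(var_q ^ (2 * Suc n)) $ 0 = 1 $ 0" by simp
  then show False by (simp add: var_q_power_nth_0 del: power_Suc mult_Suc_right)
qed

lemma sumB_Suc: "sumB (Suc n) = var_q ^ (2 * Suc n) * (sumA (Suc n) + sumB n)"
proof -
  have "Suc n * (Suc n + 1) = 2 * Suc n + Suc n * n" "n * (n + 1) = Suc n * n"
    by (simp_all add: algebra_simps)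
  then show ?thesis
    unfolding sumA_def sumB_def wsum1_Suc
    by (simp only: power_add diff_Suc_1 distrib_left mult.assoc)
qed

lemma sumA_SucSuc:
  "sumA (Suc (Suc n)) = sumB (Suc (Suc n)) + var_q ^ (2*n + 3) * sumB (Suc n)
    + var_q ^ (4*n + 4) * sumB n + var_q ^ (4*n + 2) * sumA n"
proof -
  \<comment> \<open>Every term carries the factor q^E; the remaining identity is
    \<open>wsumq_SucSuc\<close>.\<close>
  define E where "E = (n + 2) * (n + 1)"
  have e: "Suc (Suc n) * (Suc (Suc n) - 1) = E"
    "Suc (Suc n) * (Suc (Suc n) + 1) = E + (2*n + 4)"
    "2*n + 3 + Suc n * (Suc n + 1) = E + (2*n + 3)"
    "4*n + 4 + n * (n + 1) = E + (2*n + 2)"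
    by (simp_all add: E_def algebra_simps)
  \<comment> \<open>The split on \<open>n\<close> handles the truncated \<open>n - 1\<close> at
    0.\<close>
  have e': "4*n + 2 + n * (n - 1) = E"
    by (cases n) (simp_all add: E_def algebra_simps)
  have "wsumq (Suc (Suc n)) = var_q ^ (2*n + 4) * wsum1 (Suc (Suc n))
      + var_q ^ (2*n + 3) * wsum1 (Suc n) + var_q ^ (2*n + 2) * wsum1 n + wsumq n"
    using wsumq_SucSuc[of n] by simp
  then show ?thesis
    unfolding sumA_def sumB_def mult.assoc[symmetric] power_add[symmetric] e e'
    by (simp only: power_add[of _ E] distrib_left mult.assoc)
qed

lemma sumA_1: "sumA 1 = sumB 1 + var_q * sumB 0"
  using wsumq_1 by (simp add: sumA_def sumB_def power2_eq_square)

section \<open>Equality of coefficients and summation\<close>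

lemma has_sum_GF_parts_ge:
  "k > 0 \<Longrightarrow> ((\<lambda>p. var_x ^ length p * var_q ^ sum_list p) has_sum
    Abs_fps (\<lambda>m. \<Sum>n | GF (parts_ge k) n $ m \<noteq> 0. fps_X ^ n * GF (parts_ge k) n $ m)) (parts_ge k)"
  by (rule has_sum_GF) (auto simp: parts_ge_def)

lemma GF_eq_sum: "GF (parts_ge 1) = sumA" "GF (parts_ge 2) = sumB"
proof -
  have zero: "GF (parts_ge 1) 0 = sumA 0" "GF (parts_ge 2) 0 = sumB 0"
    by (simp_all add: GF_parts_ge_0 sumA_def sumB_def wsumq_0 wsum1_0)
  have "GF (parts_ge 1) n = sumA n \<and> GF (parts_ge 2) n = sumB n" for n
    by (rule system_unique[OF var_q_power_neq_1 zero GF_parts_ge_1_1 GF_parts_ge_1_SucSuc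
          GF_parts_ge_2_Suc sumA_1 sumA_SucSuc sumB_Suc])
  then show "GF (parts_ge 1) = sumA" "GF (parts_ge 2) = sumB" by auto
qed

text \<open>The bound on \<open>e\<close> makes every triple with N > m + 1 invisible at q^m, so
  each coefficient is a finite sum and the terms can be grouped by N.\<close>

lemma has_sum_wt:
  assumes e: "\<And>i j k. i + 2*j + 3*k \<le> e i j k + 1"
  shows "((\<lambda>(i, j, k). (-1) ^ k * (var_x ^ (i + 2*j + 3*k) * var_q ^ (e i j k + 3 * k\<^sup>2)) /
      (qpoch var_q var_q i * qpoch (var_q ^ 4) (var_q ^ 4) j * qpoch (var_q ^ 6) (var_q ^ 6) k)) has_sum
    Abs_fps (\<lambda>m. \<Sum>n | wsum (\<lambda>i j k. var_q ^ e i j k) n $ m \<noteq> 0.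
      fps_X ^ n * wsum (\<lambda>i j k. var_q ^ e i j k) n $ m)) UNIV"
proof -
  define c where "c = (\<lambda>(i, j, k). var_q ^ e i j k * wt i j k)"
  define d where "d = (\<lambda>(i, j, k). i + 2*j + 3*k :: nat)"
  have term_eq: "(-1) ^ k * (var_x ^ (i + 2*j + 3*k) * var_q ^ (e i j k + 3 * k\<^sup>2)) /
      (qpoch var_q var_q i * qpoch (var_q ^ 4) (var_q ^ 4) j * qpoch (var_q ^ 6) (var_q ^ 6) k)
      = var_x ^ d (i, j, k) * c (i, j, k)" for i j k
    using qpoch_nth_0[of 1 i] qpoch_nth_0[of 4 j] qpoch_nth_0[of 6 k]
    by (simp add: fps_divide_eq fps_inverse_mult_unital fps_mult_nth_0 c_def d_def wt_def
        inv_qpoch_def power_add ac_simps)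
  have "((\<lambda>p. var_x ^ d p * c p) has_sum Abs_fps (\<lambda>m. \<Sum>n | wsum (\<lambda>i j k. var_q ^ e i j k) n $ m \<noteq> 0.
      fps_X ^ n * wsum (\<lambda>i j k. var_q ^ e i j k) n $ m)) UNIV"
  proof (rule has_sum_graded)
    fix m
    have "c p $ m = 0" if "d p > m + 1" for p
    proof (cases p)
      case (fields i j k)
      then have "m < e i j k" using that e[of i j k] by (simp add: d_def)
      then show ?thesis by (simp add: fields c_def var_q_def fps_X_power_mult_nth)
    qed
    then have "{p \<in> UNIV. c p $ m \<noteq> 0} \<subseteq> (\<Union>n\<le>m + 1. tris n)"
      by (force simp: tris_def d_def not_less[symmetric])
    then show "finite {p \<in> UNIV. c p $ m \<noteq> 0}"
      by (rule finite_subset) (simp add: finite_tris)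
  next
    fix n m
    have "wsum (\<lambda>i j k. var_q ^ e i j k) n $ m = (\<Sum>p\<in>tris n. c p $ m)"
      by (simp add: wsum_def c_def fps_sum_nth case_prod_unfold)
    also have "\<dots> = (\<Sum>p | p \<in> UNIV \<and> c p $ m \<noteq> 0 \<and> d p = n. c p $ m)"
      by (rule sum.mono_neutral_right[OF finite_tris]) (auto simp: tris_def d_def)
    finally show "wsum (\<lambda>i j k. var_q ^ e i j k) n $ m =
        (\<Sum>p | p \<in> UNIV \<and> c p $ m \<noteq> 0 \<and> d p = n. c p $ m)" .
  qed
  then show ?thesis
    by (rule has_sum_cong[THEN iffD1, rotated]) (auto simp: term_eq split: prod.split)
qed

text \<open>The added 1 covers n = 1, where the product vanishes.\<close>

lemma le_mult_pred: "(n::nat) \<le> n * (n - 1) + 1"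
  by (cases n) (auto simp: add_mono)

theorem mainTheorem4:
  fixes x q :: "rat fps fps" and N :: "nat \<Rightarrow> nat \<Rightarrow> nat \<Rightarrow> nat"
  defines "x \<equiv> var_x" and "q \<equiv> var_q"
    and "N \<equiv> \<lambda>i j k. i + 2*j + 3*k"
  shows "\<exists>S S'.
    ((\<lambda>p. x ^ length p * q ^ sum_list p) has_sum S) P_set \<and>
    ((\<lambda>(i, j, k). (-1) ^ k *
        (x ^ N i j k * q ^ (N i j k * (N i j k - 1) + i + 3 * k^2)) /
        (qpoch q q i * qpoch (q^4) (q^4) j * qpoch (q^6) (q^6) k)) has_sum S) UNIV \<and>
    ((\<lambda>p. x ^ length p * q ^ sum_list p) has_sum S') P'_set \<and>
    ((\<lambda>(i, j, k). (-1) ^ k *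
        (x ^ N i j k * q ^ (N i j k * (N i j k - 1) + 2*i + 4*j + 3 * k^2 + 6*k)) /
        (qpoch q q i * qpoch (q^4) (q^4) j * qpoch (q^6) (q^6) k)) has_sum S') UNIV"
proof -
  \<comment> \<open>The shape of limit delivered by \<open>has_sum_graded\<close>: with
    \<open>sumA\<close> and \<open>sumB\<close> for \<open>F\<close> it provides the witnesses
    \<open>S\<close> and \<open>S'\<close>.\<close>
  let ?S = "\<lambda>F. Abs_fps (\<lambda>m. \<Sum>n | F n $ m \<noteq> 0. fps_X ^ n * F n $ m) :: rat fps fps"
  let ?e = "\<lambda>i j k. N i j k * (N i j k - 1) + i"
  let ?e' = "\<lambda>i j k. N i j k * (N i j k - 1) + 2*i + 4*j + 6*k"
  have e: "i + 2*j + 3*k \<le> ?e i j k + 1" "i + 2*j + 3*k \<le> ?e' i j k + 1" for i j k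
    using le_mult_pred[of "N i j k"] by (simp_all add: N_def)
  have A: "wsum (\<lambda>i j k. q ^ ?e i j k) = sumA"
    unfolding sumA_def wsumq_def wsum_cmult[symmetric]
    by (intro ext wsum_cong) (auto simp: N_def q_def power_add)
  have E: "?e' i j k = N i j k * (N i j k + 1)" for i j k
  proof -
    have "m * (m - 1) + 2 * m = m * (m + 1)" for m :: nat
      by (cases m) simp_all
    from this[of "N i j k"] show ?thesis by (simp add: N_def)
  qed
  have B: "wsum (\<lambda>i j k. q ^ ?e' i j k) = sumB"
    unfolding sumB_def wsum1_def wsum_cmult[symmetric] E
    by (intro ext wsum_cong) (simp add: N_def q_def)
  have parts: "((\<lambda>p. x ^ length p * q ^ sum_list p) has_sum ?S sumA) P_set"
    "((\<lambda>p. x ^ length p * q ^ sum_list p) has_sum ?S sumB) P'_set"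
    using has_sum_GF_parts_ge[of 1] has_sum_GF_parts_ge[of 2]
    unfolding P_set_eq P'_set_eq x_def q_def GF_eq_sum by simp_all
  have sums: "((\<lambda>(i, j, k). (-1) ^ k * (x ^ N i j k * q ^ (?e i j k + 3 * k^2)) /
      (qpoch q q i * qpoch (q^4) (q^4) j * qpoch (q^6) (q^6) k)) has_sum ?S sumA) UNIV"
    "((\<lambda>(i, j, k). (-1) ^ k * (x ^ N i j k * q ^ (?e' i j k + 3 * k^2)) /
      (qpoch q q i * qpoch (q^4) (q^4) j * qpoch (q^6) (q^6) k)) has_sum ?S sumB) UNIV"
    unfolding A[symmetric] B[symmetric] x_def q_def N_def
    by (rule has_sum_wt, use e in \<open>simp add: N_def\<close>)+
  have e': "?e' i j k + 3 * k^2 = N i j k * (N i j k - 1) + 2*i + 4*j + 3 * k^2 + 6*k" for i j k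
    by simp
  show ?thesis
    using parts sums(1) sums(2)[unfolded e'] by blast
qed

end
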